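(* For any graph $G$, $$\lceil\vartheta^+(\overline G)\rceil\le\lceil\Theta^{\mathrm{cl}(\mathcal{CS}_+)}(G)\rceil\le\lceil\Theta^{\mathcal{CS}_+}(G)\rceil\le\chi^\star(G)\le\chi_q(G).$$
   Context: Graphs are finite, undirected, without loops, with at least one vertex; $\overline G$ is the complement of $G$; $[t]=\{1,\dots,t\}$. $\mathcal S^d$ denotes the real symmetric $d\times d$ matrices with trace inner product $\langle X,Y\rangle=\mathrm{Tr}(XY)$, and $\mathcal S^d_+$ the positive semidefinite ones; $J$ is the all-ones matrix. $\mathcal{CS}_+^n$ is the set of $A\in\mathcal S^n$ for which there exist $d\ge1$ and $X_1,\dots,X_n\in\mathcal S^d_+$ with $A_{ij}=\langle X_i,X_j\rangle$ for all $i,j$; $\mathrm{cl}(\mathcal{CS}_+)$ is its closure (for each size). $\mathcal{DNN}^n$ is the cone of positive semidefinite matrices in $\mathcal S^n$ with nonnegative entries. For a cone $\mathcal K$ and $n=|V(G)|$, $\Theta^{\mathcal K}(G)$ is the infimum of $t\in\mathbb R$ for which there is $Z\in\mathcal K^n$ with $Z-J\succeq0$, $Z_{uu}=t$ for all $u\in V(G)$, and $Z_{uv}=0$ for all $\{u,v\}\in E(G)$. One has $\vartheta^+(\overline G)=\Theta^{\mathcal{DNN}}(G)$ (by definition of $\vartheta^+$). $\chi_q(G)$ is the minimum $t\in\mathbb N$ for which there exist $d\ge1$ and $\rho,\rho_u^i\in\mathcal S^d_+$ ($i\in[t]$, $u\in V(G)$) with: (a) $\langle\rho,\rho\rangle=1$;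 (b) $\sum_{i\in[t]}\rho_u^i=\rho$ for all $u\in V(G)$; (c) $\langle\rho_u^i,\rho_v^i\rangle=0$ for all $i\in[t]$ and $\{u,v\}\in E(G)$; (d) $\langle\rho_u^i,\rho_u^j\rangle=0$ for all $i\ne j\in[t]$ and $u\in V(G)$. $\chi^\star(G)$ is defined in the same way with only conditions (a), (b), (c). *)

theory Defs
  imports "HOL-Analysis.Analysis" "Jordan_Normal_Form.Matrix"
begin

text \<open>
  Two matrix types are used.  Matrices indexed by the vertices of a graph live in the library's
  Euclidean space \<open>real^'v^'v\<close>, whose topology provides the closure of a cone.  The matrices
  witnessing membership in a cone, or a quantum colouring, have a size \<open>d\<close> that is
  existentially quantified, so they are Jordan-Normal-Form matrices in \<open>carrier_mat d d\<close>.

  A graph is its adjacency relation on a finite type of vertices; being a type, it is nonempty.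
\<close>

definition simple_graph :: "('v::finite \<Rightarrow> 'v \<Rightarrow> bool) \<Rightarrow> bool" where
  "simple_graph E \<longleftrightarrow> symp E \<and> irreflp E"

definition complement_graph :: "('v::finite \<Rightarrow> 'v \<Rightarrow> bool) \<Rightarrow> 'v \<Rightarrow> 'v \<Rightarrow> bool" where
  "complement_graph E u v \<longleftrightarrow> u \<noteq> v \<and> \<not> E u v"

definition psd_mats :: "nat \<Rightarrow> real mat set" where
  "psd_mats d = {X \<in> carrier_mat d d. transpose_mat X = X \<and>
     (\<forall>v \<in> carrier_vec d. 0 \<le> scalar_prod v (X *\<^sub>v v))}"

definition mat_trace :: "real mat \<Rightarrow> real" where
  "mat_trace X = (\<Sum>a<dim_row X. X $$ (a, a))"

definition trace_inner :: "real mat \<Rightarrow> real mat \<Rightarrow> real" where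
  "trace_inner X Y = mat_trace (X * Y)"

definition PSD :: "(real^'v^'v) set" where
  "PSD = {A. Finite_Cartesian_Product.transpose A = A \<and> (\<forall>x. 0 \<le> inner x (A *v x))}"

definition DNN :: "(real^'v^'v) set" where
  "DNN = {A \<in> PSD. \<forall>u v. 0 \<le> vec_nth (vec_nth A u) v}"

definition CS_plus :: "(real^'v^'v) set" where
  "CS_plus = {A. Finite_Cartesian_Product.transpose A = A \<and>
     (\<exists>d\<ge>1. \<exists>X :: 'v \<Rightarrow> real mat. (\<forall>u. X u \<in> psd_mats d) \<and>
        (\<forall>u v. vec_nth (vec_nth A u) v = trace_inner (X u) (X v)))}"

definition all_ones :: "real^'v^'v" where
  "all_ones = (\<chi> u v. 1)"

text \<open>
  \<open>Inf\<close> on the reals is unspecified on sets that are empty or unbounded below.  Neither happens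
  for the cones used here: \<open>t = CARD('v)\<close> is feasible with \<open>Z\<close> the scalar matrix, and
  \<open>Z - J \<succeq> 0\<close> forces \<open>t \<ge> 1\<close>.
\<close>

definition Theta :: "(real^'v^'v) set \<Rightarrow> ('v::finite \<Rightarrow> 'v \<Rightarrow> bool) \<Rightarrow> real" where
  "Theta K E = Inf {t. \<exists>Z \<in> K. Z - all_ones \<in> PSD \<and>
     (\<forall>u. vec_nth (vec_nth Z u) u = t) \<and>
     (\<forall>u v. E u v \<longrightarrow> vec_nth (vec_nth Z u) v = 0)}"

definition theta_plus :: "('v::finite \<Rightarrow> 'v \<Rightarrow> bool) \<Rightarrow> real" where
  "theta_plus E = Theta DNN (complement_graph E)"

text \<open>
  Conditions (a), (b), (c): a \<open>t\<close>-colouring with \<open>\<rho>\<close> and the \<open>\<rho>\<^sub>u\<^sup>i = R u i\<close> of size \<open>d\<close>.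
  The sum in (b) is taken entrywise, as the sizes of Jordan-Normal-Form matrices are not part of
  their type and \<open>sum\<close> is therefore not available for them.
\<close>

definition star_colouring ::
    "('v::finite \<Rightarrow> 'v \<Rightarrow> bool) \<Rightarrow> nat \<Rightarrow> nat \<Rightarrow> real mat \<Rightarrow> ('v \<Rightarrow> nat \<Rightarrow> real mat) \<Rightarrow> bool" where
  "star_colouring E t d \<rho> R \<longleftrightarrow>
     \<rho> \<in> psd_mats d \<and> (\<forall>u. \<forall>i\<in>{1..t}. R u i \<in> psd_mats d) \<and>
     trace_inner \<rho> \<rho> = 1 \<and>
     (\<forall>u. Matrix.mat d d (\<lambda>ab. \<Sum>i\<in>{1..t}. R u i $$ ab) = \<rho>) \<and>
     (\<forall>i\<in>{1..t}. \<forall>u v. E u v \<longrightarrow> trace_inner (R u i) (R v i) = 0)"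

definition quantum_colouring ::
    "('v::finite \<Rightarrow> 'v \<Rightarrow> bool) \<Rightarrow> nat \<Rightarrow> nat \<Rightarrow> real mat \<Rightarrow> ('v \<Rightarrow> nat \<Rightarrow> real mat) \<Rightarrow> bool" where
  "quantum_colouring E t d \<rho> R \<longleftrightarrow>
     star_colouring E t d \<rho> R \<and>
     (\<forall>u. \<forall>i\<in>{1..t}. \<forall>j\<in>{1..t}. i \<noteq> j \<longrightarrow> trace_inner (R u i) (R u j) = 0)"

definition chi_star :: "('v::finite \<Rightarrow> 'v \<Rightarrow> bool) \<Rightarrow> nat" where
  "chi_star E = (LEAST t. \<exists>d\<ge>1. \<exists>\<rho> R. star_colouring E t d \<rho> R)"

definition chi_q :: "('v::finite \<Rightarrow> 'v \<Rightarrow> bool) \<Rightarrow> nat" where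
  "chi_q E = (LEAST t. \<exists>d\<ge>1. \<exists>\<rho> R. quantum_colouring E t d \<rho> R)"

end

theory Submission
  imports Defs
begin

text \<open>
  The first two inequalities are monotonicity of the infimum in the cone: \<open>CS_plus\<close> lies in
  \<open>DNN\<close>, because the trace inner product of two positive semidefinite matrices is nonnegative,
  and \<open>DNN\<close> is closed.  A colouring \<open>\<rho>\<close>, \<open>\<rho>\<^sub>u\<^sup>i\<close> satisfying (a), (b), (c) gives
  \<open>Y\<^sub>u\<^sub>v = t \<Sum>\<^sub>i \<langle>\<rho>\<^sub>u\<^sup>i, \<rho>\<^sub>v\<^sup>i\<rangle>\<close> in \<open>CS_plus\<close>.  Since \<open>\<Sum>\<^sub>i \<Sum>\<^sub>u x\<^sub>u \<rho>\<^sub>u\<^sup>i = (\<Sum>\<^sub>u x\<^sub>u) \<rho>\<close>,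
  the Cauchy-Schwarz inequality over \<open>i\<close> yields \<open>Y - J \<succeq> 0\<close>.  Without (d) the diagonal of \<open>Y\<close>
  is only bounded by \<open>t \<langle>\<rho>, \<rho>\<rangle> = t\<close>; adding a nonnegative diagonal matrix, which is itself in
  \<open>CS_plus\<close>, raises it to exactly \<open>t\<close>.
\<close>

section \<open>Positive semidefinite kernels on a finite index set\<close>

no_notation Matrix.vec_index (infixl "$" 100)

text \<open>Kernels over an arbitrary index set, constrained only there, let an induction remove one
  index at a time and let a direct sum be indexed by a disjoint union.\<close>

definition psd_on :: "'i set \<Rightarrow> ('i \<Rightarrow> 'i \<Rightarrow> real) \<Rightarrow> bool" where
  "psd_on I f \<longleftrightarrow> (\<forall>a\<in>I. \<forall>b\<in>I. f a b = f b a) \<and>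
     (\<forall>v. 0 \<le> (\<Sum>a\<in>I. \<Sum>b\<in>I. v a * v b * f a b))"

lemma psd_on_nonneg: "psd_on I f \<Longrightarrow> 0 \<le> (\<Sum>a\<in>I. \<Sum>b\<in>I. v a * v b * f a b)"
  by (simp add: psd_on_def)

lemma psd_on_sym: "psd_on I f \<Longrightarrow> a \<in> I \<Longrightarrow> b \<in> I \<Longrightarrow> f a b = f b a"
  by (simp add: psd_on_def)

lemma sum_insert_insert:
  fixes g :: "'i \<Rightarrow> 'i \<Rightarrow> real"
  assumes "finite I" "n \<notin> I"
  shows "(\<Sum>a\<in>insert n I. \<Sum>b\<in>insert n I. g a b) =
    (\<Sum>a\<in>I. \<Sum>b\<in>I. g a b) + (\<Sum>a\<in>I. g a n) + (\<Sum>b\<in>I. g n b) + g n n"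
  using assms by (simp add: sum.distrib)

text \<open>The form is evaluated at the vector that is \<open>v\<close> on \<open>I\<close> and
  \<open>s\<close> at \<open>n\<close>, and expanded in powers of \<open>s\<close>. Suitable choices
  of \<open>s\<close> then give both the vanishing of rows with zero pivot and the Schur
  complement.\<close>

lemma psd_on_insert_quadratic:
  fixes f :: "'i \<Rightarrow> 'i \<Rightarrow> real"
  assumes "finite I" "n \<notin> I" and psd: "psd_on (insert n I) f"
  shows "0 \<le> (\<Sum>a\<in>I. \<Sum>b\<in>I. v a * v b * f a b) + 2 * s * (\<Sum>a\<in>I. v a * f a n) + s\<^sup>2 * f n n"
proof -
  let ?w = "v(n := s)"
  have "0 \<le> (\<Sum>a\<in>insert n I. \<Sum>b\<in>insert n I. ?w a * ?w b * f a b)"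
    by (rule psd_on_nonneg[OF psd])
  also have "\<dots> = (\<Sum>a\<in>I. \<Sum>b\<in>I. ?w a * ?w b * f a b) + (\<Sum>a\<in>I. ?w a * ?w n * f a n)
      + (\<Sum>b\<in>I. ?w n * ?w b * f n b) + ?w n * ?w n * f n n"
    by (rule sum_insert_insert[OF assms(1,2)])
  also have "(\<Sum>a\<in>I. \<Sum>b\<in>I. ?w a * ?w b * f a b) = (\<Sum>a\<in>I. \<Sum>b\<in>I. v a * v b * f a b)"
    using assms(2) by (intro sum.cong refl) auto
  also have "(\<Sum>a\<in>I. ?w a * ?w n * f a n) = s * (\<Sum>a\<in>I. v a * f a n)"
    unfolding sum_distrib_left using assms(2) by (intro sum.cong refl) auto
  also have "(\<Sum>b\<in>I. ?w n * ?w b * f n b) = s * (\<Sum>a\<in>I. v a * f a n)"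
    unfolding sum_distrib_left using assms(2) psd_on_sym[OF psd]
    by (intro sum.cong refl) auto
  finally show ?thesis
    by (simp add: power2_eq_square)
qed

lemma psd_on_subset:
  assumes "finite J" "I \<subseteq> J" "psd_on J f"
  shows "psd_on I f"
  unfolding psd_on_def
proof (intro conjI allI)
  show "\<forall>a\<in>I. \<forall>b\<in>I. f a b = f b a"
    using psd_on_sym[OF assms(3)] assms(2) by (meson subsetD)
  fix v :: "_ \<Rightarrow> real"
  \<comment> \<open>Extending a vector by zero does not change the value of the form.\<close>
  let ?w = "\<lambda>a. if a \<in> I then v a else 0"
  have "0 \<le> (\<Sum>a\<in>J. \<Sum>b\<in>J. ?w a * ?w b * f a b)"
    by (rule psd_on_nonneg[OF assms(3)])
  also have "\<dots> = (\<Sum>a\<in>I. \<Sum>b\<in>J. ?w a * ?w b * f a b)"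
    by (rule sum.mono_neutral_right) (use assms in auto)
  also have "\<dots> = (\<Sum>a\<in>I. \<Sum>b\<in>I. ?w a * ?w b * f a b)"
    by (intro sum.cong refl sum.mono_neutral_right) (use assms in auto)
  also have "\<dots> = (\<Sum>a\<in>I. \<Sum>b\<in>I. v a * v b * f a b)"
    by (intro sum.cong refl) auto
  finally show "0 \<le> (\<Sum>a\<in>I. \<Sum>b\<in>I. v a * v b * f a b)" .
qed

lemma psd_on_diag_nonneg:
  assumes "finite I" "psd_on I f" "a \<in> I"
  shows "0 \<le> f a a"
proof -
  have "psd_on {a} f"
    by (rule psd_on_subset[of I]) (use assms in auto)
  from psd_on_nonneg[OF this, of "\<lambda>_. 1"] show ?thesis by simp
qed

lemma psd_on_zero_diag:
  assumes "finite I" "psd_on I f" "a \<in> I" "n \<in> I" "f n n = 0"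
  shows "f a n = 0"
proof (rule ccontr)
  assume nz: "f a n \<noteq> 0"
  then have "a \<noteq> n" using assms(5) by auto
  have "psd_on (insert n {a}) f"
    by (rule psd_on_subset[of I]) (use assms in auto)
  \<comment> \<open>With \<open>f n n = 0\<close> the form is affine in \<open>s\<close>, namely
    \<open>f a a + 2 * s * f a n\<close>. This \<open>s\<close> makes its value -1.\<close>
  from psd_on_insert_quadratic[OF _ _ this, of "\<lambda>_. 1" "- (f a a + 1) / (2 * f a n)"]
  show False using \<open>a \<noteq> n\<close> nz assms(5) by (simp add: field_simps)
qed

text \<open>If the pivot \<open>f n n\<close> vanishes, so does its whole row, and \<open>x / 0 = 0\<close> gives the right value.\<close>

lemma psd_on_schur_complement:
  fixes f :: "'i \<Rightarrow> 'i \<Rightarrow> real"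
  assumes "finite I" "n \<notin> I" and psd: "psd_on (insert n I) f"
  shows "psd_on I (\<lambda>a b. f a b - f a n * f b n / f n n)"
  unfolding psd_on_def
proof (intro conjI allI)
  show "\<forall>a\<in>I. \<forall>b\<in>I. f a b - f a n * f b n / f n n = f b a - f b n * f a n / f n n"
    using psd_on_sym[OF psd] by (simp add: mult.commute)
  fix v :: "'i \<Rightarrow> real"
  let ?S = "\<Sum>a\<in>I. v a * f a n"
  \<comment> \<open>For a positive pivot, \<open>- ?S / f n n\<close> is the minimiser of the
    quadratic in \<open>s\<close>.\<close>
  have "0 \<le> (\<Sum>a\<in>I. \<Sum>b\<in>I. v a * v b * f a b) + 2 * (- ?S / f n n) * ?S + (- ?S / f n n)\<^sup>2 * f n n"
    by (rule psd_on_insert_quadratic[OF assms])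
  also have "\<dots> = (\<Sum>a\<in>I. \<Sum>b\<in>I. v a * v b * f a b) - ?S * ?S / f n n"
    by (cases "f n n = 0") (simp_all add: field_simps power2_eq_square)
  also have "\<dots> = (\<Sum>a\<in>I. \<Sum>b\<in>I. v a * v b * (f a b - f a n * f b n / f n n))"
    unfolding sum_product sum_divide_distrib sum_subtractf[symmetric]
    by (intro sum.cong refl) (simp add: field_simps)
  finally show "0 \<le> (\<Sum>a\<in>I. \<Sum>b\<in>I. v a * v b * (f a b - f a n * f b n / f n n))" .
qed

text \<open>Symmetric elimination: \<open>f\<close> is its Schur complement at \<open>n\<close> plus
  a rank-one kernel built from column \<open>n\<close>. The induction hypothesis handles the first
  summand. The second contributes the form of \<open>g\<close> at that column, divided by the
  nonnegative pivot.\<close>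

lemma psd_on_inner_nonneg:
  fixes f g :: "'i \<Rightarrow> 'i \<Rightarrow> real"
  assumes "finite I" "psd_on I f" "psd_on I g"
  shows "0 \<le> (\<Sum>a\<in>I. \<Sum>b\<in>I. f a b * g a b)"
  using assms
proof (induction I arbitrary: f rule: finite_induct)
  case empty
  then show ?case by simp
next
  case (insert n I)
  let ?J = "insert n I"
  let ?f = "\<lambda>a b. f a b - f a n * f b n / f n n"
  \<comment> \<open>Elimination clears row and column \<open>n\<close>, so the sum over
    \<open>I\<close> equals the sum over \<open>?J\<close>. With a zero pivot nothing is subtracted,
    but the row is already zero.\<close>
  have row: "?f a n = 0" "?f n a = 0" if "a \<in> ?J" for a
    using psd_on_zero_diag[OF _ insert.prems(1) that, of n] psd_on_sym[OF insert.prems(1) that, of n]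
      insert.hyps(1) by (cases "f n n = 0"; simp)+
  have "0 \<le> (\<Sum>a\<in>I. \<Sum>b\<in>I. ?f a b * g a b)"
  proof (rule insert.IH)
    show "psd_on I ?f"
      by (rule psd_on_schur_complement[OF insert.hyps insert.prems(1)])
    show "psd_on I g"
      by (rule psd_on_subset[of ?J]) (use insert in auto)
  qed
  also have "\<dots> = (\<Sum>a\<in>?J. \<Sum>b\<in>?J. ?f a b * g a b)"
    unfolding sum_insert_insert[OF insert.hyps] by (simp only: row insertCI insertI1 insertI2 mult_zero_left sum.neutral_const add_0_right cong: sum.cong)
  finally have 1: "0 \<le> (\<Sum>a\<in>?J. \<Sum>b\<in>?J. ?f a b * g a b)" .
  have 2: "0 \<le> (\<Sum>a\<in>?J. \<Sum>b\<in>?J. f a n * f b n * g a b) / f n n"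
    using psd_on_nonneg[OF insert.prems(2), of "\<lambda>a. f a n"]
      psd_on_diag_nonneg[OF _ insert.prems(1), of n] insert.hyps by simp
  have "(\<Sum>a\<in>?J. \<Sum>b\<in>?J. f a b * g a b) =
     (\<Sum>a\<in>?J. \<Sum>b\<in>?J. ?f a b * g a b) + (\<Sum>a\<in>?J. \<Sum>b\<in>?J. f a n * f b n * g a b) / f n n"
    unfolding sum_divide_distrib sum.distrib[symmetric]
    by (intro sum.cong refl) (simp add: algebra_simps)
  with 1 2 show ?case by linarith
qed

section \<open>Passage between matrices and kernels\<close>

lemma psd_mats_imp_psd_on:
  assumes "X \<in> psd_mats d"
  shows "psd_on {..<d} (\<lambda>a b. X $$ (a, b))"
  unfolding psd_on_def
proof (intro conjI allI)
  have X: "X \<in> carrier_mat d d" "transpose_mat X = X"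
    using assms by (auto simp: psd_mats_def)
  show "\<forall>a\<in>{..<d}. \<forall>b\<in>{..<d}. X $$ (a, b) = X $$ (b, a)"
    using X by (metis carrier_matD(1,2) index_transpose_mat(1) lessThan_iff)
  fix v :: "nat \<Rightarrow> real"
  have "0 \<le> scalar_prod (Matrix.vec d v) (X *\<^sub>v Matrix.vec d v)"
    using assms by (auto simp: psd_mats_def)
  also have "\<dots> = (\<Sum>a<d. v a * (\<Sum>b<d. X $$ (a, b) * v b))"
    using X by (auto simp: scalar_prod_def atLeast0LessThan intro!: sum.cong)
  also have "\<dots> = (\<Sum>a<d. \<Sum>b<d. v a * v b * X $$ (a, b))"
    by (simp add: sum_distrib_left algebra_simps)
  finally show "0 \<le> (\<Sum>a<d. \<Sum>b<d. v a * v b * X $$ (a, b))" .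
qed

lemma psd_on_imp_psd_mats:
  assumes "psd_on {..<d} f"
  shows "Matrix.mat d d (\<lambda>(a, b). f a b) \<in> psd_mats d"
  unfolding psd_mats_def
proof (intro CollectI conjI ballI)
  let ?X = "Matrix.mat d d (\<lambda>(a, b). f a b)"
  show "transpose_mat ?X = ?X"
    using psd_on_sym[OF assms] by (intro eq_matI) auto
  fix v :: "real Matrix.vec" assume v: "v \<in> carrier_vec d"
  have "scalar_prod v (?X *\<^sub>v v) = (\<Sum>a<d. vec_index v a * (\<Sum>b<d. f a b * vec_index v b))"
    using v by (auto simp: scalar_prod_def atLeast0LessThan intro!: sum.cong)
  also have "\<dots> = (\<Sum>a<d. \<Sum>b<d. vec_index v a * vec_index v b * f a b)"
    by (simp add: sum_distrib_left algebra_simps)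
  finally show "0 \<le> scalar_prod v (?X *\<^sub>v v)"
    using psd_on_nonneg[OF assms] by simp
qed simp

text \<open>Symmetry of \<open>Y\<close> swaps the indices in its entries, which turns the trace of
  the product into the Frobenius inner product.\<close>

lemma trace_inner_conv_sum:
  assumes "X \<in> psd_mats d" "Y \<in> psd_mats d"
  shows "trace_inner X Y = (\<Sum>a<d. \<Sum>b<d. X $$ (a, b) * Y $$ (a, b))"
proof -
  have "X \<in> carrier_mat d d" "Y \<in> carrier_mat d d"
    using assms by (auto simp: psd_mats_def)
  then have "trace_inner X Y = (\<Sum>a<d. \<Sum>b<d. X $$ (a, b) * Y $$ (b, a))"
    by (auto simp: trace_inner_def mat_trace_def scalar_prod_def atLeast0LessThan intro!: sum.cong)
  also have "\<dots> = (\<Sum>a<d. \<Sum>b<d. X $$ (a, b) * Y $$ (a, b))"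
    using psd_on_sym[OF psd_mats_imp_psd_on[OF assms(2)]] by (intro sum.cong refl) auto
  finally show ?thesis .
qed

section \<open>Doubly nonnegative matrices\<close>

lemma PSD_iff:
  fixes A :: "real^'v^'v"
  shows "A \<in> PSD \<longleftrightarrow> (\<forall>u v. A $ u $ v = A $ v $ u) \<and>
    (\<forall>x. 0 \<le> (\<Sum>u\<in>UNIV. \<Sum>v\<in>UNIV. x $ u * x $ v * A $ u $ v))"
proof -
  have "Finite_Cartesian_Product.transpose A = A \<longleftrightarrow> (\<forall>u v. A $ u $ v = A $ v $ u)"
    unfolding Finite_Cartesian_Product.transpose_def Finite_Cartesian_Product.vec_eq_iff vec_lambda_beta by (rule all_comm)
  moreover have "inner x (A *v x) = (\<Sum>u\<in>UNIV. \<Sum>v\<in>UNIV. x $ u * x $ v * A $ u $ v)" for x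
    by (simp add: inner_vec_def matrix_vector_mult_def sum_distrib_left algebra_simps)
  ultimately show ?thesis
    by (simp add: PSD_def)
qed

text \<open>Unfolded, the cone is an intersection of linear equations and weak linear inequalities
  in the entries, each of which is a closed condition.\<close>

lemma closed_DNN: "closed (DNN :: (real^'v^'v) set)"
  unfolding DNN_def Collect_conj_eq PSD_iff Collect_mem_eq Collect_all_eq
  by (intro closed_Int closed_INT ballI closed_Collect_eq closed_Collect_le continuous_intros)

section \<open>The completely positive semidefinite cone \<open>CS_plus\<close>\<close>

lemma CS_plus_iff:
  fixes A :: "real^'v^'v"
  shows "A \<in> CS_plus \<longleftrightarrow> (\<exists>d::nat\<ge>1. \<exists>F. (\<forall>u. psd_on {..<d} (F u)) \<and>
    (\<forall>u v. A $ u $ v = (\<Sum>a<d. \<Sum>b<d. F u a b * F v a b)))"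
    (is "_ \<longleftrightarrow> ?R")
proof
  assume "A \<in> CS_plus"
  then obtain d X where d: "d \<ge> 1" and X: "\<And>u :: 'v. X u \<in> psd_mats d"
    and A: "\<And>u v. A $ u $ v = trace_inner (X u) (X v)"
    by (auto simp: CS_plus_def)
  have "A $ u $ v = (\<Sum>a<d. \<Sum>b<d. X u $$ (a, b) * X v $$ (a, b))" for u v
    using A trace_inner_conv_sum[OF X X] by simp
  with psd_mats_imp_psd_on[OF X] show ?R
    by - (rule exI[of _ d], rule conjI[OF d], rule exI[of _ "\<lambda>u a b. X u $$ (a, b)"], simp)
next
  assume ?R
  then obtain d :: nat and F where d: "d \<ge> 1" and F: "\<And>u :: 'v. psd_on {..<d} (F u)"
    and A: "\<And>u v. A $ u $ v = (\<Sum>a<d. \<Sum>b<d. F u a b * F v a b)"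
    by blast
  let ?X = "\<lambda>u. Matrix.mat d d (\<lambda>(a, b). F u a b)"
  have X: "?X u \<in> psd_mats d" for u
    using F by (rule psd_on_imp_psd_mats)
  have "A $ u $ v = trace_inner (?X u) (?X v)" for u v
    unfolding A trace_inner_conv_sum[OF X X] by (intro sum.cong refl) auto
  moreover have "Finite_Cartesian_Product.transpose A = A"
    by (auto simp: Finite_Cartesian_Product.transpose_def Finite_Cartesian_Product.vec_eq_iff A mult.commute)
  ultimately show "A \<in> CS_plus"
    unfolding CS_plus_def using d X
    by (intro CollectI conjI exI[of _ d] exI[of _ ?X]) auto
qed

text \<open>Enumerating \<open>I\<close> by a bijection \<open>h\<close> transports the kernels to
  \<open>{..<card I}\<close>. Block matrices and scalars can then use their natural index
  types.\<close>

lemma CS_plusI: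
  fixes A :: "real^'v^'v" and F :: "'v \<Rightarrow> 'i \<Rightarrow> 'i \<Rightarrow> real"
  assumes I: "finite I" "I \<noteq> {}" and F: "\<And>u. psd_on I (F u)"
    and A: "\<And>u v. A $ u $ v = (\<Sum>a\<in>I. \<Sum>b\<in>I. F u a b * F v a b)"
  shows "A \<in> CS_plus"
proof -
  obtain h where h: "bij_betw h {..<card I} I"
    using ex_bij_betw_nat_finite[OF I(1)] by (auto simp: atLeast0LessThan)
  have re: "(\<Sum>a\<in>I. \<Sum>b\<in>I. g a b) = (\<Sum>a<card I. \<Sum>b<card I. g (h a) (h b))"
    for g :: "'i \<Rightarrow> 'i \<Rightarrow> real"
    by (simp add: sum.reindex_bij_betw[OF h, symmetric])
  have "psd_on {..<card I} (\<lambda>a b. F u (h a) (h b))" for u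
    unfolding psd_on_def
  proof (intro conjI allI)
    show "\<forall>a\<in>{..<card I}. \<forall>b\<in>{..<card I}. F u (h a) (h b) = F u (h b) (h a)"
      using psd_on_sym[OF F] bij_betwE[OF h] by blast
    fix v :: "nat \<Rightarrow> real"
    \<comment> \<open>The test vector is carried over to \<open>I\<close> along the inverse of
      \<open>h\<close>.\<close>
    let ?w = "\<lambda>x. v (inv_into {..<card I} h x)"
    have "0 \<le> (\<Sum>a\<in>I. \<Sum>b\<in>I. ?w a * ?w b * F u a b)"
      by (rule psd_on_nonneg[OF F])
    also have "\<dots> = (\<Sum>a<card I. \<Sum>b<card I. v a * v b * F u (h a) (h b))"
      unfolding re using h by (intro sum.cong refl) (simp add: bij_betw_inv_into_left)
    finally show "0 \<le> \<dots>" .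
  qed
  moreover have d: "card I \<ge> 1"
    using I by (simp add: Suc_le_eq card_gt_0_iff)
  ultimately show ?thesis
    unfolding CS_plus_iff A re
    by - (rule exI[of _ "card I"], rule conjI[OF d], rule exI[of _ "\<lambda>u a b. F u (h a) (h b)"], simp)
qed

text \<open>A Gram matrix has as its form at \<open>x\<close> the squared Frobenius norm of the
  combination of the witnesses with coefficients \<open>x\<close>. Its entries are inner products of
  positive semidefinite kernels, hence nonnegative.\<close>

lemma CS_plus_subset_DNN: "CS_plus \<subseteq> (DNN :: (real^'v^'v) set)"
proof
  fix A :: "real^'v^'v" assume "A \<in> CS_plus"
  then obtain d :: nat and F where F: "\<And>u :: 'v. psd_on {..<d} (F u)"
    and A: "\<And>u v. A $ u $ v = (\<Sum>a<d. \<Sum>b<d. F u a b * F v a b)"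
    unfolding CS_plus_iff by blast
  have "(\<Sum>u\<in>UNIV. \<Sum>v\<in>UNIV. x $ u * x $ v * A $ u $ v) =
      (\<Sum>a<d. \<Sum>b<d. (\<Sum>u\<in>UNIV. x $ u * F u a b)\<^sup>2)" for x :: "real^'v"
  proof -
    have "(\<Sum>a<d. \<Sum>b<d. (\<Sum>u\<in>UNIV. x $ u * F u a b)\<^sup>2) =
      (\<Sum>a<d. \<Sum>b<d. \<Sum>u\<in>UNIV. \<Sum>v\<in>UNIV. x $ u * x $ v * (F u a b * F v a b))"
      by (simp add: power2_eq_square sum_product algebra_simps)
    also have "\<dots> = (\<Sum>u\<in>UNIV. \<Sum>v\<in>UNIV. \<Sum>a<d. \<Sum>b<d. x $ u * x $ v * (F u a b * F v a b))"
      by (simp only: sum.swap[of _ "UNIV :: 'v set" "{..<d}"])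
    finally show ?thesis
      by (simp add: A sum_distrib_left)
  qed
  then have "A \<in> PSD"
    unfolding PSD_iff by (auto simp: A mult.commute intro!: sum_nonneg)
  then show "A \<in> DNN"
    unfolding DNN_def using psd_on_inner_nonneg[OF _ F F] by (simp add: A)
qed

text \<open>Block-diagonal witnesses with blocks \<open>F u\<close> and \<open>G u\<close>: the
  off-diagonal blocks vanish, so the inner products add.\<close>

lemma CS_plus_add:
  fixes A B :: "real^'v^'v"
  assumes "A \<in> CS_plus" "B \<in> CS_plus"
  shows "A + B \<in> CS_plus"
proof -
  obtain d :: nat and F where d: "d \<ge> 1" and F: "\<And>u :: 'v. psd_on {..<d} (F u)"
    and A: "\<And>u v. A $ u $ v = (\<Sum>a<d. \<Sum>b<d. F u a b * F v a b)"
    using assms(1) unfolding CS_plus_iff by blast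
  obtain e :: nat and G where G: "\<And>u :: 'v. psd_on {..<e} (G u)"
    and B: "\<And>u v. B $ u $ v = (\<Sum>a<e. \<Sum>b<e. G u a b * G v a b)"
    using assms(2) unfolding CS_plus_iff by blast
  define H :: "'v \<Rightarrow> nat + nat \<Rightarrow> nat + nat \<Rightarrow> real" where
    "H u x y = (case (x, y) of (Inl a, Inl b) \<Rightarrow> F u a b | (Inr a, Inr b) \<Rightarrow> G u a b | _ \<Rightarrow> 0)" for u x y
  have H [simp]: "H u (Inl a) (Inl b) = F u a b" "H u (Inr a) (Inr b) = G u a b"
    "H u (Inl a) (Inr b) = 0" "H u (Inr a) (Inl b) = 0" for u a b
    by (simp_all add: H_def)
  show ?thesis
  proof (rule CS_plusI)
    let ?I = "{..<d} <+> {..<e}"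
    show "finite ?I" "?I \<noteq> {}"
      using d by (auto simp: lessThan_empty_iff)
    show "(A + B) $ u $ v = (\<Sum>a\<in>?I. \<Sum>b\<in>?I. H u a b * H v a b)" for u v
      by (simp add: sum.Plus A B)
    show "psd_on ?I (H u)" for u
      unfolding psd_on_def
    proof (intro conjI allI)
      show "\<forall>a\<in>?I. \<forall>b\<in>?I. H u a b = H u b a"
        using psd_on_sym[OF F] psd_on_sym[OF G] by auto
      show "0 \<le> (\<Sum>a\<in>?I. \<Sum>b\<in>?I. v a * v b * H u a b)" for v
        using psd_on_nonneg[OF F, of "\<lambda>a. v (Inl a)"] psd_on_nonneg[OF G, of "\<lambda>a. v (Inr a)"]
        by (simp add: sum.Plus add_nonneg_nonneg)
    qed
  qed
qed

text \<open>The witnesses are scalars: \<open>sqrt c\<close> at the vertex \<open>w\<close> and zero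
  at every other vertex.\<close>

lemma CS_plus_diagonal_unit:
  assumes "0 \<le> c"
  shows "(\<chi> u v. if u = w \<and> v = w then c else 0) \<in> (CS_plus :: (real^'v^'v) set)"
  by (rule CS_plusI[of "{()}" "\<lambda>u _ _. if u = w then sqrt c else 0"])
    (use assms in \<open>auto simp: psd_on_def\<close>)

lemma CS_plus_zero: "0 \<in> (CS_plus :: (real^'v^'v) set)"
  by (rule CS_plusI[of "{()}" "\<lambda>_ _ _. 0"]) (auto simp: psd_on_def)

lemma CS_plus_sum:
  "(\<And>i. i \<in> S \<Longrightarrow> f i \<in> CS_plus) \<Longrightarrow> sum f S \<in> CS_plus"
  by (induction S rule: infinite_finite_induct) (auto intro: CS_plus_add CS_plus_zero)

text \<open>A sum of matrices with one diagonal entry each. It supplies the correction that raises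
  the diagonal in \<open>star_colouring_feasible\<close>.\<close>

lemma CS_plus_diagonal:
  fixes c :: "'v::finite \<Rightarrow> real"
  assumes "\<And>u. 0 \<le> c u"
  shows "(\<chi> u v. if u = v then c u else 0) \<in> CS_plus"
proof -
  have "(\<Sum>w\<in>UNIV. \<chi> u v. if u = w \<and> v = w then c w else 0) \<in> CS_plus"
    using assms by (intro CS_plus_sum CS_plus_diagonal_unit)
  also have "(\<Sum>w\<in>UNIV. \<chi> u v. if u = w \<and> v = w then c w else 0) = (\<chi> u v. if u = v then c u else 0)"
    (is "?L = ?R")
  proof -
    have "?L $ u $ v = ?R $ u $ v" for u v
    proof -
      have "?L $ u $ v = (\<Sum>w\<in>UNIV. if w = u then if u = v then c u else 0 else 0)"
        unfolding sum_component by (intro sum.cong) auto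
      then show ?thesis by simp
    qed
    then show ?thesis by (simp add: Finite_Cartesian_Product.vec_eq_iff)
  qed
  finally show ?thesis .
qed

text \<open>The entries are bilinear in the witnesses, so each witness is scaled by
  \<open>sqrt c\<close>.\<close>

lemma CS_plus_scale:
  fixes A :: "real^'v^'v"
  assumes "A \<in> CS_plus" "0 \<le> c"
  shows "c *\<^sub>R A \<in> CS_plus"
proof -
  obtain d :: nat and F where d: "d \<ge> 1" and F: "\<And>u :: 'v. psd_on {..<d} (F u)"
    and A: "\<And>u v. A $ u $ v = (\<Sum>a<d. \<Sum>b<d. F u a b * F v a b)"
    using assms(1) unfolding CS_plus_iff by blast
  show ?thesis
  proof (rule CS_plusI)
    show "psd_on {..<d} (\<lambda>a b. sqrt c * F u a b)" for u
      unfolding psd_on_def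
    proof (intro conjI allI)
      show "\<forall>a\<in>{..<d}. \<forall>b\<in>{..<d}. sqrt c * F u a b = sqrt c * F u b a"
        using psd_on_sym[OF F] by auto
      fix v :: "nat \<Rightarrow> real"
      have "0 \<le> sqrt c * (\<Sum>a<d. \<Sum>b<d. v a * v b * F u a b)"
        using assms(2) psd_on_nonneg[OF F] by simp
      then show "0 \<le> (\<Sum>a<d. \<Sum>b<d. v a * v b * (sqrt c * F u a b))"
        by (simp add: sum_distrib_left algebra_simps)
    qed
    have "sqrt c * x * (sqrt c * y) = c * (x * y)" for x y
      using assms(2) real_sqrt_mult_self[of c] by (metis abs_of_nonneg mult.assoc mult.left_commute)
    then show "(c *\<^sub>R A) $ u $ v = (\<Sum>a<d. \<Sum>b<d. sqrt c * F u a b * (sqrt c * F v a b))" for u v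
      by (simp only: vector_scaleR_component A sum_distrib_left real_scaleR_def)
  qed (use d in \<open>auto simp: lessThan_empty_iff\<close>)
qed

section \<open>Feasible values and monotonicity of \<open>Theta\<close>\<close>

definition feasible :: "(real^'v^'v) set \<Rightarrow> ('v::finite \<Rightarrow> 'v \<Rightarrow> bool) \<Rightarrow> real set" where
  "feasible K E = {t. \<exists>Z \<in> K. Z - all_ones \<in> PSD \<and> (\<forall>u. Z $ u $ u = t) \<and>
     (\<forall>u v. E u v \<longrightarrow> Z $ u $ v = 0)}"

lemma Theta_eq_Inf_feasible: "Theta K E = Inf (feasible K E)"
  by (simp add: Theta_def feasible_def)

lemma feasible_mono: "K \<subseteq> L \<Longrightarrow> feasible K E \<subseteq> feasible L E"
  by (auto simp: feasible_def)

lemma feasible_ge_1: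
  fixes E :: "'v::finite \<Rightarrow> 'v \<Rightarrow> bool"
  assumes "t \<in> feasible K E"
  shows "1 \<le> t"
proof -
  obtain Z :: "real^'v^'v" where Z: "Z - all_ones \<in> PSD" "\<And>u. Z $ u $ u = t"
    using assms unfolding feasible_def by blast
  \<comment> \<open>Types are nonempty, so a vertex exists; the form of \<open>Z - all_ones\<close>
    at its axis vector is the diagonal entry \<open>t - 1\<close>.\<close>
  fix u :: 'v
  have "0 \<le> inner (axis u 1) ((Z - all_ones) *v axis u 1)"
    using Z(1) by (simp add: PSD_def)
  also have "\<dots> = t - 1"
    by (simp add: inner_axis' matrix_vector_mult_basis column_def Z(2) all_ones_def)
  finally show ?thesis by simp
qed

lemma bdd_below_feasible: "bdd_below (feasible K E)"
  using feasible_ge_1 by (rule bdd_belowI)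

text \<open>Enlarging the cone enlarges the feasible set. Nonemptiness for the smaller cone keeps
  its \<open>Inf\<close> away from the unspecified value on the empty set.\<close>

lemma Theta_antimono:
  assumes "K \<subseteq> L" "feasible K E \<noteq> {}"
  shows "Theta L E \<le> Theta K E"
  unfolding Theta_eq_Inf_feasible
  by (intro cInf_superset_mono assms bdd_below_feasible feasible_mono)

section \<open>From a colouring to a feasible matrix\<close>

lemma star_colouring_feasible:
  fixes E :: "'v::finite \<Rightarrow> 'v \<Rightarrow> bool"
  assumes "irreflp E" and d: "d \<ge> 1" and col: "star_colouring E t d \<rho> R"
  shows "real t \<in> feasible CS_plus E"
proof -
  define T where "T = {1..t}"
  have T [simp]: "finite T" "card T = t"
    by (simp_all add: T_def)
  define r where "r u i a b = R u i $$ (a, b)" for u i a b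
  define q where "q a b = \<rho> $$ (a, b)" for a b
  have \<rho>: "\<rho> \<in> psd_mats d" and R: "\<And>u i. i \<in> T \<Longrightarrow> R u i \<in> psd_mats d"
    and one: "trace_inner \<rho> \<rho> = 1"
    and tot: "\<And>u. Matrix.mat d d (\<lambda>ab. \<Sum>i\<in>T. R u i $$ ab) = \<rho>"
    and edge: "\<And>i u v. i \<in> T \<Longrightarrow> E u v \<Longrightarrow> trace_inner (R u i) (R v i) = 0"
    using col unfolding star_colouring_def T_def by blast+
  have psd: "psd_on {..<d} (r u i)" if "i \<in> T" for u i
    using psd_mats_imp_psd_on[OF R[OF that]] by (simp add: r_def[abs_def])
  have one': "(\<Sum>a<d. \<Sum>b<d. (q a b)\<^sup>2) = 1"
    using one trace_inner_conv_sum[OF \<rho> \<rho>] by (simp add: q_def power2_eq_square)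
  have tot': "(\<Sum>i\<in>T. r u i a b) = q a b" if "a < d" "b < d" for u a b
    unfolding q_def r_def using tot[of u, symmetric] that by simp
  \<comment> \<open>The Gram matrix of the operators of one colour, over all vertices.\<close>
  define G where "G i = (\<chi> u v. \<Sum>a<d. \<Sum>b<d. r u i a b * r v i a b)" for i
  have G_CS: "G i \<in> CS_plus" if "i \<in> T" for i
    by (rule CS_plusI[OF _ _ psd[OF that]]) (use d in \<open>auto simp: G_def lessThan_empty_iff\<close>)
  define Y where "Y = real t *\<^sub>R (\<Sum>i\<in>T. G i)"
  have Y: "Y $ u $ v = t * (\<Sum>i\<in>T. \<Sum>a<d. \<Sum>b<d. r u i a b * r v i a b)" for u v
    by (simp add: Y_def G_def)
  \<comment> \<open>Cross terms between colours at a vertex are nonnegative, so the squared norms of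
    the parts sum to at most the squared norm of their total \<open>\<rho>\<close>, which is
    1.\<close>
  have diag: "Y $ u $ u \<le> t" for u
  proof -
    have *: "(\<Sum>i\<in>T. \<Sum>a<d. \<Sum>b<d. r u i a b * r u j a b) = (\<Sum>a<d. \<Sum>b<d. q a b * r u j a b)" for j
    proof -
      have "(\<Sum>i\<in>T. \<Sum>a<d. \<Sum>b<d. r u i a b * r u j a b) = (\<Sum>a<d. \<Sum>b<d. \<Sum>i\<in>T. r u i a b * r u j a b)"
        by (simp only: sum.swap[of _ _ T])
      then show ?thesis
        by (simp add: sum_distrib_right[symmetric] tot')
    qed
    have "(\<Sum>j\<in>T. \<Sum>a<d. \<Sum>b<d. r u j a b * r u j a b)
        \<le> (\<Sum>j\<in>T. \<Sum>i\<in>T. \<Sum>a<d. \<Sum>b<d. r u i a b * r u j a b)"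
    proof (rule sum_mono)
      fix j assume j: "j \<in> T"
      show "(\<Sum>a<d. \<Sum>b<d. r u j a b * r u j a b) \<le> (\<Sum>i\<in>T. \<Sum>a<d. \<Sum>b<d. r u i a b * r u j a b)"
        by (rule member_le_sum[OF j]) (auto intro!: psd_on_inner_nonneg psd j)
    qed
    also have "\<dots> = (\<Sum>j\<in>T. \<Sum>a<d. \<Sum>b<d. q a b * r u j a b)"
      by (simp only: *)
    also have "\<dots> = (\<Sum>a<d. \<Sum>b<d. \<Sum>j\<in>T. q a b * r u j a b)"
      by (simp only: sum.swap[of _ _ T])
    also have "\<dots> = (\<Sum>a<d. \<Sum>b<d. (q a b)\<^sup>2)"
      by (simp add: sum_distrib_left[symmetric] tot' power2_eq_square)
    finally show ?thesis
      unfolding Y one' by (simp add: mult_left_le)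
  qed
  \<comment> \<open>The slack left by \<open>diag\<close>; being diagonal, \<open>D\<close> does not
    disturb the zeros at edges.\<close>
  define D :: "real^'v^'v" where "D = (\<chi> u v. if u = v then real t - Y $ u $ u else 0)"
  have D_CS: "D \<in> CS_plus"
    unfolding D_def using diag by (intro CS_plus_diagonal) simp
  have "Y \<in> CS_plus"
    unfolding Y_def using G_CS by (intro CS_plus_scale CS_plus_sum) auto
  then have Z_CS: "Y + D \<in> CS_plus"
    using D_CS by (rule CS_plus_add)
  have Y_psd: "Y - all_ones \<in> PSD"
    unfolding PSD_iff
  proof (intro conjI allI)
    show "(Y - all_ones) $ u $ v = (Y - all_ones) $ v $ u" for u v
      by (simp add: Y all_ones_def mult.commute)
    fix x :: "real^'v"
    define y where "y i a b = (\<Sum>u\<in>UNIV. x $ u * r u i a b)" for i a b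
    define s where "s = (\<Sum>u\<in>UNIV. x $ u)"
    \<comment> \<open>By (b), every vertex contributes the same total \<open>q\<close>, weighted by
      its coordinate of \<open>x\<close>.\<close>
    have ysum: "(\<Sum>i\<in>T. y i a b) = s * q a b" if "a < d" "b < d" for a b
    proof -
      have "(\<Sum>i\<in>T. y i a b) = (\<Sum>u\<in>UNIV. \<Sum>i\<in>T. x $ u * r u i a b)"
        unfolding y_def by (rule sum.swap)
      also have "\<dots> = s * q a b"
        by (simp add: sum_distrib_left[symmetric] tot'[OF that] s_def sum_distrib_right)
      finally show ?thesis .
    qed
    have "s\<^sup>2 = (\<Sum>a<d. \<Sum>b<d. (s * q a b)\<^sup>2)"
      by (simp add: power_mult_distrib sum_distrib_left[symmetric] one')
    \<comment> \<open>The factor 1 prepares Cauchy-Schwarz against the constant vector, whose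
      squared norm \<open>t\<close> is the scaling factor in \<open>Y\<close>.\<close>
    also have "\<dots> = (\<Sum>a<d. \<Sum>b<d. (\<Sum>i\<in>T. 1 * y i a b)\<^sup>2)"
      by (simp add: ysum)
    also have "\<dots> \<le> (\<Sum>a<d. \<Sum>b<d. (\<Sum>i\<in>T. 1\<^sup>2) * (\<Sum>i\<in>T. (y i a b)\<^sup>2))"
      by (intro sum_mono Cauchy_Schwarz_ineq_sum)
    also have "\<dots> = t * (\<Sum>a<d. \<Sum>b<d. \<Sum>i\<in>T. (y i a b)\<^sup>2)"
      by (simp add: sum_distrib_left)
    also have "(\<Sum>a<d. \<Sum>b<d. \<Sum>i\<in>T. (y i a b)\<^sup>2) =
        (\<Sum>a<d. \<Sum>b<d. \<Sum>i\<in>T. \<Sum>u\<in>UNIV. \<Sum>v\<in>UNIV. x $ u * x $ v * (r u i a b * r v i a b))"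
      by (simp add: y_def power2_eq_square sum_product algebra_simps)
    also have "\<dots> = (\<Sum>i\<in>T. \<Sum>a<d. \<Sum>b<d. \<Sum>u\<in>UNIV. \<Sum>v\<in>UNIV. x $ u * x $ v * (r u i a b * r v i a b))"
      by (simp only: sum.swap[of _ T "{..<d}"])
    also have "\<dots> = (\<Sum>u\<in>UNIV. \<Sum>v\<in>UNIV. \<Sum>i\<in>T. \<Sum>a<d. \<Sum>b<d. x $ u * x $ v * (r u i a b * r v i a b))"
      by (simp only: sum.swap[of _ "UNIV :: 'v set" "{..<d}"] sum.swap[of _ "UNIV :: 'v set" T])
    also have "t * \<dots> = (\<Sum>u\<in>UNIV. \<Sum>v\<in>UNIV. x $ u * x $ v * Y $ u $ v)"
      by (simp add: Y sum_distrib_left algebra_simps)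
    finally have "s\<^sup>2 \<le> (\<Sum>u\<in>UNIV. \<Sum>v\<in>UNIV. x $ u * x $ v * Y $ u $ v)" .
    \<comment> \<open>\<open>s\<close> squared is also the form of the all-ones matrix at
      \<open>x\<close>.\<close>
    moreover have "s\<^sup>2 = (\<Sum>u\<in>UNIV. \<Sum>v\<in>UNIV. x $ u * x $ v)"
      by (simp add: s_def power2_eq_square sum_product)
    ultimately show "0 \<le> (\<Sum>u\<in>UNIV. \<Sum>v\<in>UNIV. x $ u * x $ v * (Y - all_ones) $ u $ v)"
      by (simp add: all_ones_def right_diff_distrib sum_subtractf)
  qed
  have "D \<in> PSD"
    using D_CS CS_plus_subset_DNN by (auto simp: DNN_def)
  with Y_psd have "Y - all_ones + D \<in> PSD"
    unfolding PSD_iff by (simp add: ring_distribs sum.distrib add_nonneg_nonneg)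
  then have Z_psd: "Y + D - all_ones \<in> PSD"
    by (simp add: algebra_simps)
  have "(Y + D) $ u $ v = 0" if "E u v" for u v
  proof -
    have "u \<noteq> v"
      using that assms(1) by (auto simp: irreflp_def)
    moreover have "(\<Sum>a<d. \<Sum>b<d. r u i a b * r v i a b) = 0" if "i \<in> T" for i
      using edge[OF that \<open>E u v\<close>] trace_inner_conv_sum[OF R R, OF that that] by (simp add: r_def)
    ultimately show ?thesis
      by (simp add: D_def Y)
  qed
  moreover have "(Y + D) $ u $ u = real t" for u
    by (simp add: D_def)
  ultimately show ?thesis
    using Z_CS Z_psd unfolding feasible_def by blast
qed

section \<open>Existence of colourings and the chain of inequalities\<close>

lemma quantum_colouring_exists:
  fixes E :: "'v::finite \<Rightarrow> 'v \<Rightarrow> bool"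
  assumes "irreflp E"
  shows "\<exists>t. \<exists>d\<ge>1. \<exists>\<rho> R. quantum_colouring E t d \<rho> R"
proof -
  let ?n = "CARD('v)"
  \<comment> \<open>The classical colouring with a separate colour for each vertex, realised by 0/1
    scalars in dimension 1.\<close>
  obtain h :: "'v \<Rightarrow> nat" where h: "bij_betw h UNIV {1..?n}"
    using finite_same_card_bij[of "UNIV :: 'v set" "{1..?n}"] by auto
  have hin: "h u \<in> {1..?n}" for u
    using h by (rule bij_betw_apply) simp
  have hinj: "h u = h v \<longleftrightarrow> u = v" for u v
    using h by (auto simp: bij_betw_def inj_eq)
  define s :: "real \<Rightarrow> real mat" where "s c = Matrix.mat 1 1 (\<lambda>_. c)" for c
  have s: "s c \<in> psd_mats 1" if "c \<ge> 0" for c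
    using psd_on_imp_psd_mats[of 1 "\<lambda>_ _. c"] that by (simp add: psd_on_def s_def case_prod_unfold)
  have tr: "trace_inner (s c) (s e) = c * e" for c e
    by (simp add: s_def trace_inner_def mat_trace_def scalar_prod_def)
  define R where "R u i = s (if h u = i then 1 else 0)" for u i
  have "Matrix.mat 1 1 (\<lambda>ab. \<Sum>i\<in>{1..?n}. R u i $$ ab) = s 1" for u
    by (intro eq_matI) (use hin[of u] in \<open>auto simp: R_def s_def if_distrib[of "\<lambda>x. Matrix.mat _ _ x $$ _"]\<close>)
  moreover have "\<not> E u u" for u
    using assms by (auto simp: irreflp_def)
  ultimately have "quantum_colouring E ?n 1 (s 1) R"
    using s by (auto simp: quantum_colouring_def star_colouring_def tr R_def hinj)
  then show ?thesis by blast
qed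

theorem proposition4p15:
  fixes E :: "'v::finite \<Rightarrow> 'v \<Rightarrow> bool"
  assumes "simple_graph E"
  shows "\<lceil>theta_plus (complement_graph E)\<rceil> \<le> \<lceil>Theta (closure CS_plus) E\<rceil> \<and>
         \<lceil>Theta (closure CS_plus) E\<rceil> \<le> \<lceil>Theta CS_plus E\<rceil> \<and>
         \<lceil>Theta CS_plus E\<rceil> \<le> int (chi_star E) \<and>
         chi_star E \<le> chi_q E"
proof -
  have irr: "irreflp E"
    using assms by (simp add: simple_graph_def)
  \<comment> \<open>Complementing twice removes loops and changes nothing else, so irreflexivity
    gives back \<open>E\<close> and \<open>theta_plus\<close> becomes
    \<open>Theta DNN E\<close>.\<close>
  have compl: "complement_graph (complement_graph E) = E"
    using irr by (auto simp: complement_graph_def fun_eq_iff irreflp_def)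
  have "\<exists>d\<ge>1. \<exists>\<rho> R. quantum_colouring E (chi_q E) d \<rho> R"
    unfolding chi_q_def by (rule LeastI_ex[OF quantum_colouring_exists[OF irr]])
  \<comment> \<open>Dropping (d) keeps the number of colours, so \<open>chi_q E\<close> competes in
    the minimum defining \<open>chi_star E\<close>.\<close>
  then have star: "\<exists>d\<ge>1. \<exists>\<rho> R. star_colouring E (chi_q E) d \<rho> R"
    by (auto simp: quantum_colouring_def)
  then have le: "chi_star E \<le> chi_q E"
    unfolding chi_star_def by (rule Least_le)
  from star have "\<exists>d\<ge>1. \<exists>\<rho> R. star_colouring E (chi_star E) d \<rho> R"
    unfolding chi_star_def by (rule LeastI)
  \<comment> \<open>This feasible value bounds \<open>Theta CS_plus E\<close> and also gives the
    nonemptiness required by both comparisons of cones.\<close>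
  then have feas: "real (chi_star E) \<in> feasible CS_plus E"
    using star_colouring_feasible[OF irr] by blast
  then have "Theta CS_plus E \<le> real (chi_star E)"
    unfolding Theta_eq_Inf_feasible by (intro cInf_lower bdd_below_feasible)
  moreover have "Theta (closure CS_plus) E \<le> Theta CS_plus E"
    using feas by (intro Theta_antimono closure_subset) auto
  moreover have "Theta DNN E \<le> Theta (closure CS_plus) E"
  proof (rule Theta_antimono)
    show "closure CS_plus \<subseteq> (DNN :: (real^'v^'v) set)"
      by (rule closure_minimal[OF CS_plus_subset_DNN closed_DNN])
    show "feasible (closure CS_plus) E \<noteq> {}"
      using feas feasible_mono[OF closure_subset] by blast
  qed
  \<comment> \<open>Ceilings preserve the order, and the bound by \<open>chi_star E\<close> survives
    rounding up because it is an integer.\<close>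
  ultimately show ?thesis
    unfolding theta_plus_def compl using le by (intro conjI ceiling_mono) (simp_all add: ceiling_le_iff)
qed

end
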